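(* Let $k:\mathbb{R}^d\times\mathbb{R}^d\to\mathbb{R}$ be a (symmetric, positive) reproducing kernel with reproducing kernel Hilbert space $\mathcal{H}_k$, and assume: (a) there exist constants $K_1,K_2>0$ such that for all $x,y\in\mathbb{R}^d$, $k(x,x)+k(y,y)-2k(x,y)\le K_1^2\|x-y\|^2$, and $K_2=\sqrt{k(0,0)}$; (b) if $\mu$ is a signed measure on $\mathbb{R}^d$, then $$\int_{\mathbb{R}^d}k(x,y)\,\mathrm{d}\mu(y)=0\ \text{ for all }x\in\mathbb{R}^d\quad\Longrightarrow\quad\mu\equiv0.$$ Then for any $\mu\in\mathcal{P}^1(\mathbb{R}^d)$, $\Phi=\{f\in\mathcal{H}_k:\|f\|_{\mathcal{H}_k}\le1\}$ satisfies the function class assumption (stated in the context) with $A_1=K_1$, $A_2=K_2$ and $A_3=\sqrt2\max\{K_1,K_2\}$.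
   Context: $\|\cdot\|$ is the Euclidean norm; $\mathrm{Lip}(f)=\sup_{x\ne y}|f(x)-f(y)|/\|x-y\|$; $\mathcal{P}^1(\mathbb{R}^d)$ is the set of probability measures on $\mathbb{R}^d$ with finite first moment. A symmetric function $k:\mathbb{R}^d\times\mathbb{R}^d\to\mathbb{R}$ is a positive kernel function if $\sum_{i,j=1}^na_ia_jk(x^i,x^j)\ge0$ for all $n\in\mathbb{N}$, $x^1,\dots,x^n\in\mathbb{R}^d$, $a_1,\dots,a_n\in\mathbb{R}$. $\mathcal{H}_k$ is the completion of the span of the functions $k(\cdot,x)$, $x\in\mathbb{R}^d$, under the inner product determined by $\langle k(x,\cdot),k(y,\cdot)\rangle_{\mathcal{H}_k}=k(x,y)$; it satisfies $f(x)=\langle f,k(x,\cdot)\rangle_{\mathcal{H}_k}$ for all $x\in\mathbb{R}^d$, $f\in\mathcal{H}_k$. Function class assumption: a set $\Phi$ of functions on $\mathbb{R}^d$ satisfies the assumption if (i) whenever $\mu$ is a signed measure on $\mathbb{R}^d$ with $\int_{\mathbb{R}^d}f\,\mathrm{d}\mu=0$ for all $f\in\Phi$, then $\mu\equiv0$; (ii) there exist two constants $A_1:=\sup_{f\in\Phi}\mathrm{Lip}(f)<+\infty$ and $A_2:=\sup_{f\in\Phi}|f(0)|<+\infty$; (iii) there exists a constant $A_3>0$ such that for any $\mathcal{X}=\{x^1,\dots,x^n\}\subset\mathbb{R}^d$ the empirical Rademacher complexity satisfies $$\mathrm{Rad}_n(\Phi,\mathcal{X}):=\frac1n\mathbb{E}\sup_{f\in\Phi}\Bigl|\sum_{i=1}^n\xi_if(x^i)\Bigr|\le\frac{A_3}{n}\sqrt{\sum_{i=1}^n(\|x^i\|^2+1)},$$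 where $\xi_1,\dots,\xi_n$ are i.i.d. with $\mathbb{P}(\xi_i=1)=\mathbb{P}(\xi_i=-1)=\frac12$.
   Formalization: A_1 = K_1 fails literally for non-minimal K_1 in (a), since A_1 is the exact supremum of Lip(f) (Gaussian kernel: K_1=2 is admissible, A_1=1); the formal statement gives A_1 ≤ K_1, with A_1 = K_1 when K_1 is the least positive constant admissible in (a). *)

theory Defs
  imports "HOL-Analysis.Analysis" "HOL-Probability.Probability"
begin

section \<open>Positive kernels and their reproducing kernel Hilbert space\<close>

definition positive_kernel :: "('a \<Rightarrow> 'a \<Rightarrow> real) \<Rightarrow> bool" where
  "positive_kernel k \<longleftrightarrow>
     (\<forall>x y. k x y = k y x) \<and>
     (\<forall>(n::nat) (x :: nat \<Rightarrow> 'a) (a :: nat \<Rightarrow> real).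
        (\<Sum>i<n. \<Sum>j<n. a i * a j * k (x i) (x j)) \<ge> 0)"

definition kernel_comb :: "('a \<Rightarrow> 'a \<Rightarrow> real) \<Rightarrow> 'a set \<Rightarrow> ('a \<Rightarrow> real) \<Rightarrow> 'a \<Rightarrow> real" where
  "kernel_comb k S a = (\<lambda>y. \<Sum>x\<in>S. a x * k y x)"

definition kernel_span :: "('a \<Rightarrow> 'a \<Rightarrow> real) \<Rightarrow> ('a \<Rightarrow> real) set" where
  "kernel_span k = {kernel_comb k S a | S a. finite S}"

text \<open>
  The bilinear extension of \<open>\<langle>k(\<cdot>,x), k(\<cdot>,y)\<rangle> = k(x,y)\<close> to the span. The value does not depend
  on the chosen representations, see \<open>pre_inner_comb\<close> below.
\<close>

definition pre_inner :: "('a \<Rightarrow> 'a \<Rightarrow> real) \<Rightarrow> ('a \<Rightarrow> real) \<Rightarrow> ('a \<Rightarrow> real) \<Rightarrow> real" where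
  "pre_inner k f g = (THE r. \<exists>S a T b. finite S \<and> finite T \<and>
      f = kernel_comb k S a \<and> g = kernel_comb k T b \<and>
      r = (\<Sum>x\<in>S. \<Sum>y\<in>T. a x * b y * k x y))"

definition pre_norm :: "('a \<Rightarrow> 'a \<Rightarrow> real) \<Rightarrow> ('a \<Rightarrow> real) \<Rightarrow> real" where
  "pre_norm k f = sqrt (pre_inner k f f)"

text \<open>
  The completion of the span is realised as a space of functions: its elements are the pointwise
  limits of the sequences in the span that are Cauchy for the norm of the span. Such a sequence
  always converges pointwise, and its limit function determines its class modulo null sequences,
  so the inner product of the completion is well defined, see \<open>rkhs_inner_eqI\<close> below.
\<close>

definition rkhs_approx :: "('a \<Rightarrow> 'a \<Rightarrow> real) \<Rightarrow> (nat \<Rightarrow> 'a \<Rightarrow> real) \<Rightarrow> ('a \<Rightarrow> real) \<Rightarrow> bool" where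
  "rkhs_approx k F f \<longleftrightarrow>
     (\<forall>n. F n \<in> kernel_span k) \<and>
     (\<forall>e>0. \<exists>N. \<forall>m\<ge>N. \<forall>n\<ge>N. pre_norm k (\<lambda>x. F m x - F n x) < e) \<and>
     (\<forall>x. (\<lambda>n. F n x) \<longlonglongrightarrow> f x)"

definition rkhs :: "('a \<Rightarrow> 'a \<Rightarrow> real) \<Rightarrow> ('a \<Rightarrow> real) set" where
  "rkhs k = {f. \<exists>F. rkhs_approx k F f}"

definition rkhs_inner :: "('a \<Rightarrow> 'a \<Rightarrow> real) \<Rightarrow> ('a \<Rightarrow> real) \<Rightarrow> ('a \<Rightarrow> real) \<Rightarrow> real" where
  "rkhs_inner k f g = (THE r. \<exists>F G. rkhs_approx k F f \<and> rkhs_approx k G g \<and>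
      (\<lambda>n. pre_inner k (F n) (G n)) \<longlonglongrightarrow> r)"

definition rkhs_norm :: "('a \<Rightarrow> 'a \<Rightarrow> real) \<Rightarrow> ('a \<Rightarrow> real) \<Rightarrow> real" where
  "rkhs_norm k f = sqrt (rkhs_inner k f f)"

definition rkhs_unit_ball :: "('a \<Rightarrow> 'a \<Rightarrow> real) \<Rightarrow> ('a \<Rightarrow> real) set" where
  "rkhs_unit_ball k = {f \<in> rkhs k. rkhs_norm k f \<le> 1}"


section \<open>Well-definedness of the inner products and the reproducing property\<close>

lemma kernel_comb_in_span: "finite S \<Longrightarrow> kernel_comb k S a \<in> kernel_span k"
  by (auto simp: kernel_span_def)

lemma kernel_spanE:
  assumes "f \<in> kernel_span k"
  obtains S a where "finite S" "f = kernel_comb k S a"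
  using assms by (auto simp: kernel_span_def)

lemma kernel_section_eq_comb: "(\<lambda>y. k y x) = kernel_comb k {x} (\<lambda>_. 1)"
  by (simp add: kernel_comb_def)

lemma kernel_span_lincomb:
  assumes "f \<in> kernel_span k" "g \<in> kernel_span k"
  shows "(\<lambda>x. c * f x + d * g x) \<in> kernel_span k"
proof -
  obtain S a T b where S: "finite S" "f = kernel_comb k S a"
    and T: "finite T" "g = kernel_comb k T b"
    using assms by (metis kernel_spanE)
  let ?c = "\<lambda>x. c * (if x \<in> S then a x else 0) + d * (if x \<in> T then b x else 0)"
  have "c * f y + d * g y = kernel_comb k (S \<union> T) ?c y" for y
  proof -
    have 1: "(\<Sum>x\<in>S. a x * k y x) = (\<Sum>x\<in>S \<union> T. (if x \<in> S then a x else 0) * k y x)"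
      by (rule sum.mono_neutral_cong_left) (use S T in auto)
    have 2: "(\<Sum>x\<in>T. b x * k y x) = (\<Sum>x\<in>S \<union> T. (if x \<in> T then b x else 0) * k y x)"
      by (rule sum.mono_neutral_cong_left) (use S T in auto)
    show ?thesis
      unfolding S(2) T(2) kernel_comb_def 1 2 sum_distrib_left sum.distrib[symmetric]
      by (intro sum.cong refl) (simp add: algebra_simps)
  qed
  then have "(\<lambda>y. c * f y + d * g y) = kernel_comb k (S \<union> T) ?c" by blast
  then show ?thesis using S T by (simp add: kernel_comb_in_span)
qed

lemma kernel_span_diff:
  assumes "f \<in> kernel_span k" "g \<in> kernel_span k"
  shows "(\<lambda>x. f x - g x) \<in> kernel_span k"
  using kernel_span_lincomb[OF assms, of 1 "-1"] by simp

context
  fixes k :: "'a \<Rightarrow> 'a \<Rightarrow> real"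
  assumes k: "positive_kernel k"
begin

lemma kernel_sym: "k x y = k y x"
  using k by (simp add: positive_kernel_def)

lemma double_sum_eq:
  "(\<Sum>x\<in>S. \<Sum>y\<in>T. a x * b y * k x y) = (\<Sum>y\<in>T. b y * kernel_comb k S a y)"
  "(\<Sum>x\<in>S. \<Sum>y\<in>T. a x * b y * k x y) = (\<Sum>x\<in>S. a x * kernel_comb k T b x)"
proof -
  show "(\<Sum>x\<in>S. \<Sum>y\<in>T. a x * b y * k x y) = (\<Sum>y\<in>T. b y * kernel_comb k S a y)"
    unfolding kernel_comb_def sum_distrib_left
    by (subst sum.swap, intro sum.cong refl) (simp add: kernel_sym mult_ac)
  show "(\<Sum>x\<in>S. \<Sum>y\<in>T. a x * b y * k x y) = (\<Sum>x\<in>S. a x * kernel_comb k T b x)"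
    unfolding kernel_comb_def sum_distrib_left by (simp add: mult_ac)
qed

lemma pre_inner_comb:
  assumes "finite S" "finite T"
  shows "pre_inner k (kernel_comb k S a) (kernel_comb k T b)
           = (\<Sum>x\<in>S. \<Sum>y\<in>T. a x * b y * k x y)"
  unfolding pre_inner_def
proof (rule the_equality)
  show "\<exists>S' a' T' b'. finite S' \<and> finite T' \<and> kernel_comb k S a = kernel_comb k S' a' \<and>
      kernel_comb k T b = kernel_comb k T' b' \<and>
      (\<Sum>x\<in>S. \<Sum>y\<in>T. a x * b y * k x y) = (\<Sum>x\<in>S'. \<Sum>y\<in>T'. a' x * b' y * k x y)"
    using assms by blast
next
  fix r
  assume "\<exists>S' a' T' b'. finite S' \<and> finite T' \<and> kernel_comb k S a = kernel_comb k S' a' \<and>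
      kernel_comb k T b = kernel_comb k T' b' \<and> r = (\<Sum>x\<in>S'. \<Sum>y\<in>T'. a' x * b' y * k x y)"
  then show "r = (\<Sum>x\<in>S. \<Sum>y\<in>T. a x * b y * k x y)"
    by (metis double_sum_eq)
qed

lemma pre_inner_comb_right:
  assumes "f \<in> kernel_span k" "finite T"
  shows "pre_inner k f (kernel_comb k T b) = (\<Sum>y\<in>T. b y * f y)"
  using assms(1) by (rule kernel_spanE) (simp add: pre_inner_comb assms(2) double_sum_eq(1))

lemma pre_inner_section: "f \<in> kernel_span k \<Longrightarrow> pre_inner k f (\<lambda>y. k y x) = f x"
  by (simp add: kernel_section_eq_comb pre_inner_comb_right)

lemma pre_inner_commute:
  assumes "f \<in> kernel_span k" "g \<in> kernel_span k"
  shows "pre_inner k f g = pre_inner k g f"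
proof -
  obtain S a T b where S: "finite S" "f = kernel_comb k S a"
    and T: "finite T" "g = kernel_comb k T b"
    using assms by (metis kernel_spanE)
  show ?thesis
    by (simp add: S T pre_inner_comb) (subst sum.swap, intro sum.cong refl, simp add: kernel_sym)
qed

lemma pre_inner_lincomb_left:
  assumes "f \<in> kernel_span k" "g \<in> kernel_span k" "h \<in> kernel_span k"
  shows "pre_inner k (\<lambda>x. c * f x + d * g x) h = c * pre_inner k f h + d * pre_inner k g h"
proof -
  obtain T b where T: "finite T" "h = kernel_comb k T b" using assms(3) by (rule kernel_spanE)
  show ?thesis
    using assms kernel_span_lincomb[OF assms(1,2), of c d]
    by (simp add: T pre_inner_comb_right sum_distrib_left sum.distrib algebra_simps)
qed

lemma pre_inner_lincomb_right:
  assumes "f \<in> kernel_span k" "g \<in> kernel_span k" "h \<in> kernel_span k"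
  shows "pre_inner k h (\<lambda>x. c * f x + d * g x) = c * pre_inner k h f + d * pre_inner k h g"
  using pre_inner_lincomb_left[OF assms, of c d] assms kernel_span_lincomb[OF assms(1,2), of c d]
  by (simp add: pre_inner_commute)

lemma pre_inner_diff:
  assumes "f \<in> kernel_span k" "g \<in> kernel_span k" "h \<in> kernel_span k"
  shows "pre_inner k (\<lambda>x. f x - g x) h = pre_inner k f h - pre_inner k g h"
    and "pre_inner k h (\<lambda>x. f x - g x) = pre_inner k h f - pre_inner k h g"
  using pre_inner_lincomb_left[OF assms, of 1 "-1"] pre_inner_lincomb_right[OF assms, of 1 "-1"]
  by simp_all

lemma pre_inner_nonneg:
  assumes "f \<in> kernel_span k"
  shows "pre_inner k f f \<ge> 0"
proof -
  obtain S a where S: "finite S" "f = kernel_comb k S a" using assms by (rule kernel_spanE)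
  obtain h where h: "bij_betw h {..<card S} S"
    using ex_bij_betw_nat_finite[OF S(1)] by (auto simp: atLeast0LessThan)
  have "(\<Sum>x\<in>S. \<Sum>y\<in>S. a x * a y * k x y)
      = (\<Sum>i<card S. \<Sum>j<card S. a (h i) * a (h j) * k (h i) (h j))"
    unfolding sum.reindex_bij_betw[OF h, symmetric, where 'a=real] by (rule refl)
  also have "\<dots> \<ge> 0"
    using k unfolding positive_kernel_def by (elim conjE) (erule allE[of _ "card S"],
      erule allE[of _ h], erule allE[of _ "\<lambda>i. a (h i)"], assumption)
  finally show ?thesis by (simp add: S pre_inner_comb)
qed

lemma pre_norm_nonneg: "f \<in> kernel_span k \<Longrightarrow> pre_norm k f \<ge> 0"
  by (simp add: pre_norm_def pre_inner_nonneg)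

lemma pre_norm_square: "f \<in> kernel_span k \<Longrightarrow> (pre_norm k f)\<^sup>2 = pre_inner k f f"
  by (simp add: pre_norm_def pre_inner_nonneg)

lemma pre_inner_Cauchy_Schwarz:
  assumes f: "f \<in> kernel_span k" and g: "g \<in> kernel_span k"
  shows "\<bar>pre_inner k f g\<bar> \<le> pre_norm k f * pre_norm k g"
proof -
  let ?a = "pre_inner k f f" and ?b = "pre_inner k f g" and ?c = "pre_inner k g g"
  have quad: "0 \<le> ?a + 2 * t * ?b + t\<^sup>2 * ?c" for t
  proof -
    let ?h = "\<lambda>x. 1 * f x + t * g x"
    have "?h \<in> kernel_span k" by (rule kernel_span_lincomb[OF f g])
    from pre_inner_nonneg[OF this] have "0 \<le> pre_inner k ?h ?h" .
    also have "\<dots> = ?a + 2 * t * ?b + t\<^sup>2 * ?c"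
      by (simp only: pre_inner_lincomb_left[OF f g \<open>?h \<in> kernel_span k\<close>]
          pre_inner_lincomb_right[OF f g f] pre_inner_lincomb_right[OF f g g]
          pre_inner_commute[OF g f]) (simp add: algebra_simps power2_eq_square)
    finally show ?thesis .
  qed
  have "?b\<^sup>2 \<le> ?a * ?c"
  proof (cases "?c = 0")
    case True
    have "?b = 0"
    proof (rule ccontr)
      assume "?b \<noteq> 0"
      then show False using quad[of "- (?a + 1) / (2 * ?b)"] True by (simp add: field_simps)
    qed
    then show ?thesis using True by simp
  next
    case False
    then have "?c > 0" using pre_inner_nonneg[OF g] by simp
    then show ?thesis using quad[of "- ?b / ?c"]
      by (simp add: field_simps power2_eq_square)
  qed
  then have "sqrt (?b\<^sup>2) \<le> sqrt (?a * ?c)" by (rule real_sqrt_le_mono)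
  then show ?thesis by (simp add: pre_norm_def real_sqrt_mult)
qed

lemma pre_norm_triangle:
  assumes f: "f \<in> kernel_span k" and g: "g \<in> kernel_span k"
  shows "pre_norm k (\<lambda>x. c * f x + d * g x) \<le> \<bar>c\<bar> * pre_norm k f + \<bar>d\<bar> * pre_norm k g"
proof (rule power2_le_imp_le)
  let ?h = "\<lambda>x. c * f x + d * g x"
  have h: "?h \<in> kernel_span k" by (rule kernel_span_lincomb[OF f g])
  have "(pre_norm k ?h)\<^sup>2 = c\<^sup>2 * pre_inner k f f + 2 * (c * d * pre_inner k f g)
      + d\<^sup>2 * pre_inner k g g"
    unfolding pre_norm_square[OF h]
    by (simp only: pre_inner_lincomb_left[OF f g h] pre_inner_lincomb_right[OF f g f]
        pre_inner_lincomb_right[OF f g g] pre_inner_commute[OF g f])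
      (simp add: algebra_simps power2_eq_square)
  moreover have "c * d * pre_inner k f g \<le> \<bar>c\<bar> * \<bar>d\<bar> * (pre_norm k f * pre_norm k g)"
  proof -
    have "c * d * pre_inner k f g \<le> \<bar>c * d\<bar> * \<bar>pre_inner k f g\<bar>"
      by (metis abs_ge_self abs_mult)
    also have "\<dots> \<le> \<bar>c * d\<bar> * (pre_norm k f * pre_norm k g)"
      by (intro mult_left_mono pre_inner_Cauchy_Schwarz f g) simp
    finally show ?thesis by (simp add: abs_mult)
  qed
  ultimately show "(pre_norm k ?h)\<^sup>2 \<le> (\<bar>c\<bar> * pre_norm k f + \<bar>d\<bar> * pre_norm k g)\<^sup>2"
    by (simp add: power2_sum power_mult_distrib pre_norm_square f g mult_ac)
qed (use f g pre_norm_nonneg in simp)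

lemma pre_norm_diff_triangle:
  assumes f: "f \<in> kernel_span k" and g: "g \<in> kernel_span k"
  shows "pre_norm k (\<lambda>x. f x - g x) \<le> pre_norm k f + pre_norm k g"
  using pre_norm_triangle[OF f g, of 1 "-1"] by simp

lemma rkhs_approx_span: "rkhs_approx k F f \<Longrightarrow> F n \<in> kernel_span k"
  by (simp add: rkhs_approx_def)

lemma rkhs_approx_diff:
  assumes F: "rkhs_approx k F f" and G: "rkhs_approx k G g"
  shows "rkhs_approx k (\<lambda>n x. F n x - G n x) (\<lambda>x. f x - g x)"
  unfolding rkhs_approx_def
proof (intro conjI allI impI)
  fix n show "(\<lambda>x. F n x - G n x) \<in> kernel_span k"
    using F G by (simp add: kernel_span_diff rkhs_approx_span)
next
  fix x show "(\<lambda>n. F n x - G n x) \<longlonglongrightarrow> f x - g x"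
    using F G by (intro tendsto_diff) (auto simp: rkhs_approx_def)
next
  fix e :: real assume "e > 0"
  then have "e / 2 > 0" by simp
  obtain N1 where N1: "\<And>m n. m \<ge> N1 \<Longrightarrow> n \<ge> N1 \<Longrightarrow> pre_norm k (\<lambda>x. F m x - F n x) < e / 2"
    using F \<open>e / 2 > 0\<close> unfolding rkhs_approx_def by meson
  obtain N2 where N2: "\<And>m n. m \<ge> N2 \<Longrightarrow> n \<ge> N2 \<Longrightarrow> pre_norm k (\<lambda>x. G m x - G n x) < e / 2"
    using G \<open>e / 2 > 0\<close> unfolding rkhs_approx_def by meson
  have "pre_norm k (\<lambda>x. (F m x - G m x) - (F n x - G n x)) < e"
    if "m \<ge> max N1 N2" "n \<ge> max N1 N2" for m n
  proof -
    have "(\<lambda>x. F m x - F n x) \<in> kernel_span k" "(\<lambda>x. G m x - G n x) \<in> kernel_span k"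
      using F G by (simp_all add: kernel_span_diff rkhs_approx_span)
    from pre_norm_diff_triangle[OF this]
    have "pre_norm k (\<lambda>x. (F m x - F n x) - (G m x - G n x)) < e"
      using N1[of m n] N2[of m n] that by simp
    moreover have "(\<lambda>x. (F m x - F n x) - (G m x - G n x)) = (\<lambda>x. (F m x - G m x) - (F n x - G n x))"
      by auto
    ultimately show ?thesis by simp
  qed
  then show "\<exists>N. \<forall>m\<ge>N. \<forall>n\<ge>N. pre_norm k (\<lambda>x. (F m x - G m x) - (F n x - G n x)) < e"
    by blast
qed

lemma rkhs_approx_bounded:
  assumes F: "rkhs_approx k F f"
  shows "\<exists>B>0. \<forall>n. pre_norm k (F n) \<le> B"
proof -
  have "\<exists>N. \<forall>m\<ge>N. \<forall>n\<ge>N. pre_norm k (\<lambda>x. F m x - F n x) < 1"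
    using F by (simp add: rkhs_approx_def)
  then obtain N where N: "\<And>n. n \<ge> N \<Longrightarrow> pre_norm k (\<lambda>x. F n x - F N x) < 1"
    by blast
  let ?B = "Max ((\<lambda>n. pre_norm k (F n)) ` {..N}) + 1"
  have small: "pre_norm k (F n) \<le> ?B - 1" if "n \<le> N" for n
    using that by (auto intro: Max_ge)
  have "pre_norm k (F n) \<le> ?B" for n
  proof (cases "n \<le> N")
    case True then show ?thesis using small[of n] by linarith
  next
    case False
    have d: "(\<lambda>x. F n x - F N x) \<in> kernel_span k" "F N \<in> kernel_span k"
      using F by (simp_all add: kernel_span_diff rkhs_approx_span)
    have "pre_norm k (F n) \<le> pre_norm k (\<lambda>x. F n x - F N x) + pre_norm k (F N)"
      using pre_norm_triangle[OF d, of 1 1] by simp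
    then show ?thesis using N[of n] small[of N] False by linarith
  qed
  moreover have "?B > 0"
    using small[of N] pre_norm_nonneg[OF rkhs_approx_span[OF F, of N]] by linarith
  ultimately show ?thesis by blast
qed

lemma rkhs_approx_zero:
  assumes D: "rkhs_approx k D (\<lambda>_. 0)"
  shows "(\<lambda>n. pre_norm k (D n)) \<longlonglongrightarrow> 0"
proof -
  have sp: "D n \<in> kernel_span k" for n using D by (rule rkhs_approx_span)
  obtain B where B: "B > 0" "\<And>n. pre_norm k (D n) \<le> B" using rkhs_approx_bounded[OF D] by blast
  have "(\<lambda>n. pre_inner k (D n) (D n)) \<longlonglongrightarrow> 0"
  proof (rule LIMSEQ_I)
    fix e :: real assume e: "e > 0"
    then have "e / (2 * B) > 0" using B by simp
    with D have "\<exists>N. \<forall>m\<ge>N. \<forall>n\<ge>N. pre_norm k (\<lambda>x. D m x - D n x) < e / (2 * B)"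
      unfolding rkhs_approx_def by blast
    then obtain N where N: "\<And>n. n \<ge> N \<Longrightarrow> pre_norm k (\<lambda>x. D n x - D N x) < e / (2 * B)"
      by blast
    obtain T b where T: "finite T" "D N = kernel_comb k T b" using sp by (rule kernel_spanE)
    have "(\<lambda>n. \<Sum>y\<in>T. b y * D n y) \<longlonglongrightarrow> (\<Sum>y\<in>T. b y * 0)"
      using D by (intro tendsto_intros) (auto simp: rkhs_approx_def)
    then have "(\<lambda>n. pre_inner k (D n) (D N)) \<longlonglongrightarrow> 0"
      by (simp add: T pre_inner_comb_right sp)
    from LIMSEQ_D[OF this half_gt_zero[OF e]]
    obtain M where M: "\<And>n. n \<ge> M \<Longrightarrow> \<bar>pre_inner k (D n) (D N)\<bar> < e / 2"
      by auto
    have "norm (pre_inner k (D n) (D n) - 0) < e" if n: "n \<ge> max M N" for n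
    proof -
      have "\<bar>pre_inner k (D n) (\<lambda>x. D n x - D N x)\<bar>
          \<le> pre_norm k (D n) * pre_norm k (\<lambda>x. D n x - D N x)"
        by (intro pre_inner_Cauchy_Schwarz sp kernel_span_diff)
      also have "\<dots> \<le> B * (e / (2 * B))"
      proof (rule mult_mono)
        show "pre_norm k (D n) \<le> B" using B by blast
        show "pre_norm k (\<lambda>x. D n x - D N x) \<le> e / (2 * B)" using N[of n] n by simp
        show "0 \<le> B" using B by simp
        show "0 \<le> pre_norm k (\<lambda>x. D n x - D N x)"
          by (intro pre_norm_nonneg kernel_span_diff sp)
      qed
      also have "\<dots> = e / 2" using B by simp
      finally have "\<bar>pre_inner k (D n) (\<lambda>x. D n x - D N x)\<bar> \<le> e / 2" .
      moreover have "\<bar>pre_inner k (D n) (D N)\<bar> < e / 2" using M n by simp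
      moreover have "pre_inner k (D n) (\<lambda>x. D n x - D N x)
          = pre_inner k (D n) (D n) - pre_inner k (D n) (D N)"
        by (rule pre_inner_diff(2)[OF sp sp sp])
      ultimately show ?thesis unfolding real_norm_def by linarith
    qed
    then show "\<exists>no. \<forall>n\<ge>no. norm (pre_inner k (D n) (D n) - 0) < e" by blast
  qed
  from tendsto_real_sqrt[OF this] show ?thesis by (simp add: pre_norm_def)
qed

lemma rkhs_approx_unique:
  assumes F: "rkhs_approx k F f" and F': "rkhs_approx k F' f"
    and G: "rkhs_approx k G g" and G': "rkhs_approx k G' g"
  shows "(\<lambda>n. pre_inner k (F n) (G n) - pre_inner k (F' n) (G' n)) \<longlonglongrightarrow> 0"
proof -
  let ?D = "\<lambda>n x. F n x - F' n x" and ?E = "\<lambda>n x. G n x - G' n x"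
  have sp: "F n \<in> kernel_span k" "F' n \<in> kernel_span k" "G n \<in> kernel_span k"
    "G' n \<in> kernel_span k" for n
    using F F' G G' by (simp_all add: rkhs_approx_span)
  have D0: "(\<lambda>n. pre_norm k (?D n)) \<longlonglongrightarrow> 0" and E0: "(\<lambda>n. pre_norm k (?E n)) \<longlonglongrightarrow> 0"
    using rkhs_approx_diff[OF F F'] rkhs_approx_diff[OF G G'] by (simp_all add: rkhs_approx_zero)
  obtain B where B: "B > 0" "\<And>n. pre_norm k (G n) \<le> B" using rkhs_approx_bounded[OF G] by blast
  obtain C where C: "C > 0" "\<And>n. pre_norm k (F' n) \<le> C" using rkhs_approx_bounded[OF F'] by blast
  have "norm (pre_inner k (F n) (G n) - pre_inner k (F' n) (G' n))
      \<le> pre_norm k (?D n) * B + C * pre_norm k (?E n)" for n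
  proof -
    have "pre_inner k (F n) (G n) - pre_inner k (F' n) (G' n)
        = pre_inner k (?D n) (G n) + pre_inner k (F' n) (?E n)"
      using sp by (simp add: pre_inner_diff)
    moreover have "\<bar>pre_inner k (?D n) (G n)\<bar> \<le> pre_norm k (?D n) * pre_norm k (G n)"
      "\<bar>pre_inner k (F' n) (?E n)\<bar> \<le> pre_norm k (F' n) * pre_norm k (?E n)"
      using sp by (simp_all add: pre_inner_Cauchy_Schwarz kernel_span_diff)
    moreover have "pre_norm k (?D n) * pre_norm k (G n) \<le> pre_norm k (?D n) * B"
      "pre_norm k (F' n) * pre_norm k (?E n) \<le> C * pre_norm k (?E n)"
      by (intro mult_left_mono mult_right_mono B C pre_norm_nonneg kernel_span_diff sp)+
    ultimately show ?thesis by simp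
  qed
  moreover have "(\<lambda>n. pre_norm k (?D n) * B + C * pre_norm k (?E n)) \<longlonglongrightarrow> 0 * B + C * 0"
    by (intro tendsto_add tendsto_mult tendsto_const D0 E0)
  then have "(\<lambda>n. pre_norm k (?D n) * B + C * pre_norm k (?E n)) \<longlonglongrightarrow> 0" by simp
  ultimately show ?thesis by (metis (no_types, lifting) Lim_null_comparison always_eventually)
qed

lemma rkhs_inner_eqI:
  assumes "rkhs_approx k F f" "rkhs_approx k G g" "(\<lambda>n. pre_inner k (F n) (G n)) \<longlonglongrightarrow> r"
  shows "rkhs_inner k f g = r"
  unfolding rkhs_inner_def
proof (rule the_equality)
  show "\<exists>F G. rkhs_approx k F f \<and> rkhs_approx k G g \<and> (\<lambda>n. pre_inner k (F n) (G n)) \<longlonglongrightarrow> r"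
    using assms by blast
next
  fix s
  assume "\<exists>F G. rkhs_approx k F f \<and> rkhs_approx k G g \<and> (\<lambda>n. pre_inner k (F n) (G n)) \<longlonglongrightarrow> s"
  then obtain F' G' where *: "rkhs_approx k F' f" "rkhs_approx k G' g"
    "(\<lambda>n. pre_inner k (F' n) (G' n)) \<longlonglongrightarrow> s" by blast
  have "(\<lambda>n. pre_inner k (F n) (G n) - pre_inner k (F' n) (G' n)) \<longlonglongrightarrow> r - s"
    by (intro tendsto_diff assms *)
  with rkhs_approx_unique[OF assms(1) *(1) assms(2) *(2)] show "s = r"
    using LIMSEQ_unique by fastforce
qed

lemma rkhs_inner_LIMSEQ:
  assumes F: "rkhs_approx k F f" and G: "rkhs_approx k G g"
  shows "(\<lambda>n. pre_inner k (F n) (G n)) \<longlonglongrightarrow> rkhs_inner k f g"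
proof -
  have sp: "F n \<in> kernel_span k" "G n \<in> kernel_span k" for n
    using F G by (simp_all add: rkhs_approx_span)
  obtain B where B: "B > 0" "\<And>n. pre_norm k (F n) \<le> B" using rkhs_approx_bounded[OF F] by blast
  obtain C where C: "C > 0" "\<And>n. pre_norm k (G n) \<le> C" using rkhs_approx_bounded[OF G] by blast
  have "Cauchy (\<lambda>n. pre_inner k (F n) (G n))"
  proof (rule CauchyI)
    fix e :: real assume "e > 0"
    then have pos: "e / (2 * B) > 0" "e / (2 * C) > 0" using B C by simp_all
    obtain N1 where N1: "\<And>m n. m \<ge> N1 \<Longrightarrow> n \<ge> N1 \<Longrightarrow>
        pre_norm k (\<lambda>x. F m x - F n x) < e / (2 * C)"
      using F pos unfolding rkhs_approx_def by meson
    obtain N2 where N2: "\<And>m n. m \<ge> N2 \<Longrightarrow> n \<ge> N2 \<Longrightarrow>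
        pre_norm k (\<lambda>x. G m x - G n x) < e / (2 * B)"
      using G pos unfolding rkhs_approx_def by meson
    have "norm (pre_inner k (F m) (G m) - pre_inner k (F n) (G n)) < e"
      if mn: "m \<ge> max N1 N2" "n \<ge> max N1 N2" for m n
    proof -
      let ?D = "\<lambda>x. F m x - F n x" and ?E = "\<lambda>x. G m x - G n x"
      have "pre_inner k (F m) (G m) - pre_inner k (F n) (G n)
          = pre_inner k ?D (G m) + pre_inner k (F n) ?E"
        using sp by (simp add: pre_inner_diff)
      moreover have "\<bar>pre_inner k ?D (G m)\<bar> \<le> pre_norm k ?D * pre_norm k (G m)"
        "\<bar>pre_inner k (F n) ?E\<bar> \<le> pre_norm k (F n) * pre_norm k ?E"
        using sp by (simp_all add: pre_inner_Cauchy_Schwarz kernel_span_diff)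
      moreover have "pre_norm k ?D * pre_norm k (G m) \<le> pre_norm k ?D * C"
        "pre_norm k (F n) * pre_norm k ?E \<le> B * pre_norm k ?E"
        by (intro mult_left_mono mult_right_mono B C pre_norm_nonneg kernel_span_diff sp)+
      moreover have "pre_norm k ?D * C < e / (2 * C) * C" "B * pre_norm k ?E < B * (e / (2 * B))"
        using N1[of m n] N2[of m n] mn B C by (simp_all add: field_simps)
      moreover have "e / (2 * C) * C = e / 2" "B * (e / (2 * B)) = e / 2" using B C by simp_all
      ultimately show ?thesis by simp
    qed
    then show "\<exists>M. \<forall>m\<ge>M. \<forall>n\<ge>M. norm (pre_inner k (F m) (G m) - pre_inner k (F n) (G n)) < e"
      by blast
  qed
  then obtain r where "(\<lambda>n. pre_inner k (F n) (G n)) \<longlonglongrightarrow> r"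
    using Cauchy_convergent convergent_def by blast
  with rkhs_inner_eqI[OF F G] show ?thesis by simp
qed

lemma rkhs_approx_const:
  assumes "f \<in> kernel_span k"
  shows "rkhs_approx k (\<lambda>_. f) f"
proof -
  have "pre_inner k (\<lambda>x. 0) (\<lambda>x. 0) = 0"
    using pre_inner_comb[of "{}" "{}"] by (simp add: kernel_comb_def)
  then show ?thesis using assms by (simp add: rkhs_approx_def pre_norm_def)
qed

lemma kernel_span_subset_rkhs: "kernel_span k \<subseteq> rkhs k"
  using rkhs_approx_const by (auto simp: rkhs_def)

lemma kernel_section_in_rkhs: "(\<lambda>y. k y x) \<in> rkhs k"
  using kernel_span_subset_rkhs kernel_comb_in_span[of "{x}" k] by (auto simp: kernel_section_eq_comb)

lemma rkhs_reproducing: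
  assumes "f \<in> rkhs k"
  shows "rkhs_inner k f (\<lambda>y. k y x) = f x"
proof -
  obtain F where F: "rkhs_approx k F f" using assms by (auto simp: rkhs_def)
  have s: "(\<lambda>y. k y x) \<in> kernel_span k" by (simp add: kernel_section_eq_comb kernel_comb_in_span)
  show ?thesis
    by (rule rkhs_inner_eqI[OF F rkhs_approx_const[OF s]])
      (use F in \<open>simp add: pre_inner_section rkhs_approx_span, simp add: rkhs_approx_def\<close>)
qed

end


section \<open>Signed measures\<close>

definition signed_measure :: "('a::topological_space set \<Rightarrow> real) \<Rightarrow> bool" where
  "signed_measure \<nu> \<longleftrightarrow> \<nu> {} = 0 \<and>
     (\<forall>A :: nat \<Rightarrow> 'a set. range A \<subseteq> sets borel \<longrightarrow> disjoint_family A \<longrightarrow>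
        (\<lambda>n. \<nu> (A n)) sums \<nu> (\<Union>n. A n))"

text \<open>
  Positive and negative part of the Jordan decomposition: the value of the positive part at \<open>A\<close> is
  the supremum of \<open>\<nu> B\<close> over the measurable \<open>B \<subseteq> A\<close>. As \<open>ennreal\<close> truncates negative numbers to
  \<open>0\<close> and \<open>\<nu> {} = 0\<close>, the truncation does not change that supremum.
\<close>

definition jordan_pos :: "('a::topological_space set \<Rightarrow> real) \<Rightarrow> 'a measure" where
  "jordan_pos \<nu> = measure_of UNIV (sets borel) (\<lambda>A. SUP B\<in>{B \<in> sets borel. B \<subseteq> A}. ennreal (\<nu> B))"

definition jordan_neg :: "('a::topological_space set \<Rightarrow> real) \<Rightarrow> 'a measure" where
  "jordan_neg \<nu> = jordan_pos (\<lambda>A. - \<nu> A)"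

text \<open>
  The integral of \<open>f\<close> against \<open>\<nu>\<close> exists and equals \<open>r\<close>; integrability against both parts is
  integrability against the total variation.
\<close>

definition has_signed_integral ::
    "('a::topological_space \<Rightarrow> real) \<Rightarrow> real \<Rightarrow> ('a set \<Rightarrow> real) \<Rightarrow> bool" where
  "has_signed_integral f r \<nu> \<longleftrightarrow>
     integrable (jordan_pos \<nu>) f \<and> integrable (jordan_neg \<nu>) f \<and>
     r = integral\<^sup>L (jordan_pos \<nu>) f - integral\<^sup>L (jordan_neg \<nu>) f"

lemma signed_measure_uminus: "signed_measure \<nu> \<Longrightarrow> signed_measure (\<lambda>A. - \<nu> A)"
  by (simp add: signed_measure_def sums_minus)

lemma signed_measure_Un:
  assumes "signed_measure \<nu>" "A \<in> sets borel" "B \<in> sets borel" "A \<inter> B = {}"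
  shows "\<nu> (A \<union> B) = \<nu> A + \<nu> B"
proof -
  have "range (binaryset A B) \<subseteq> sets borel" "disjoint_family (binaryset A B)"
    using assms by (auto simp: range_binaryset_eq disjoint_family_on_def binaryset_def)
  then have "(\<lambda>n. \<nu> (binaryset A B n)) sums \<nu> (\<Union>n. binaryset A B n)"
    using assms(1) unfolding signed_measure_def by blast
  moreover have "(\<lambda>n. \<nu> (binaryset A B n)) sums (\<nu> A + \<nu> B)"
    using assms(1) by (intro binaryset_sums) (simp add: signed_measure_def)
  ultimately show ?thesis by (simp add: UN_binaryset_eq sums_unique2)
qed

lemma emeasure_jordan_pos:
  assumes \<nu>: "signed_measure \<nu>" and A: "A \<in> sets borel"
  shows "emeasure (jordan_pos \<nu>) A = (SUP B\<in>{B \<in> sets borel. B \<subseteq> A}. ennreal (\<nu> B))"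
proof -
  define v where "v A = (SUP B\<in>{B \<in> sets borel. B \<subseteq> A}. ennreal (\<nu> B))" for A
  have \<nu>0: "\<nu> {} = 0" using \<nu> by (simp add: signed_measure_def)
  have le_v: "ennreal (\<nu> B) \<le> v A" if "B \<in> sets borel" "B \<subseteq> A" for A B
    unfolding v_def using that by (intro SUP_upper) auto
  have super: "v X + v Y \<le> v (X \<union> Y)" if XY: "X \<inter> Y = {}" for X Y
  proof -
    have pair: "ennreal (\<nu> B) + ennreal (\<nu> C) \<le> v (X \<union> Y)"
      if B: "B \<in> sets borel" "B \<subseteq> X" and C: "C \<in> sets borel" "C \<subseteq> Y" for B C
    proof (cases "\<nu> B \<ge> 0 \<and> \<nu> C \<ge> 0")
      case True
      have "B \<inter> C = {}" using B C XY by blast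
      with True have "ennreal (\<nu> B) + ennreal (\<nu> C) = ennreal (\<nu> (B \<union> C))"
        using signed_measure_Un[OF \<nu> B(1) C(1)] by (subst ennreal_plus[symmetric]) auto
      then show ?thesis using le_v[of "B \<union> C" "X \<union> Y"] B C by auto
    next
      case False
      then have "ennreal (\<nu> B) = 0 \<or> ennreal (\<nu> C) = 0" by (auto simp: ennreal_neg)
      moreover have "B \<subseteq> X \<union> Y" "C \<subseteq> X \<union> Y" using B C by auto
      ultimately show ?thesis using le_v[OF B(1)] le_v[OF C(1)] by auto
    qed
    have ne: "{B \<in> sets borel. B \<subseteq> Z} \<noteq> {}" for Z :: "'a set" by blast
    have "v X + ennreal (\<nu> C) \<le> v (X \<union> Y)" if "C \<in> sets borel" "C \<subseteq> Y" for C
      unfolding v_def[of X]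
      by (subst ennreal_SUP_add_left[symmetric, OF ne]) (use that pair in \<open>auto intro!: SUP_least\<close>)
    then show ?thesis
      unfolding v_def[of Y]
      by (subst ennreal_SUP_add_right[OF ne]) (auto intro!: SUP_least)
  qed
  have "countably_additive (sets borel) v"
  proof (rule countably_additiveI)
    fix A :: "nat \<Rightarrow> 'a set"
    assume A: "range A \<subseteq> sets borel" "disjoint_family A"
    have upper: "v (\<Union>i. A i) \<le> (\<Sum>i. v (A i))"
      unfolding v_def[of "\<Union>i. A i"]
    proof (rule SUP_least)
      fix B assume "B \<in> {B \<in> sets borel. B \<subseteq> (\<Union>i. A i)}"
      then have B: "B \<in> sets borel" "(\<Union>i. B \<inter> A i) = B" by auto
      have "(\<lambda>n. \<nu> (B \<inter> A n)) sums \<nu> (\<Union>n. B \<inter> A n)"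
        using A B by (intro \<nu>[unfolded signed_measure_def, THEN conjunct2, rule_format])
          (auto simp: disjoint_family_on_def)
      then have "(\<lambda>n. \<Sum>i<n. \<nu> (B \<inter> A i)) \<longlonglongrightarrow> \<nu> B" unfolding sums_def B(2) .
      then have "(\<lambda>n. ennreal (\<Sum>i<n. \<nu> (B \<inter> A i))) \<longlonglongrightarrow> ennreal (\<nu> B)"
        by (rule tendsto_ennrealI)
      moreover have "ennreal (\<Sum>i<n. \<nu> (B \<inter> A i)) \<le> (\<Sum>i. v (A i))" for n
      proof -
        have "ennreal (\<Sum>i<n. \<nu> (B \<inter> A i)) \<le> ennreal (\<Sum>i<n. max 0 (\<nu> (B \<inter> A i)))"
          by (intro ennreal_leI sum_mono) simp
        also have "\<dots> = (\<Sum>i<n. ennreal (\<nu> (B \<inter> A i)))"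
          by (subst sum_ennreal[symmetric]) (auto simp: max_def ennreal_neg intro!: sum.cong simp del: sum_ennreal)
        also have "\<dots> \<le> (\<Sum>i<n. v (A i))"
          using A B by (intro sum_mono le_v) auto
        also have "\<dots> \<le> (\<Sum>i. v (A i))" by (intro sum_le_suminf) auto
        finally show ?thesis .
      qed
      ultimately show "ennreal (\<nu> B) \<le> (\<Sum>i. v (A i))"
        by (intro LIMSEQ_le_const2) auto
    qed
    have "(\<Sum>i<n. v (A i)) \<le> v (\<Union>i<n. A i)" for n
    proof (induction n)
      case 0 show ?case by simp
    next
      case (Suc n)
      have "A n \<inter> A i = {}" if "i < n" for i
        using disjoint_family_onD[OF A(2), of n i] that by simp
      then have "A n \<inter> (\<Union>i<n. A i) = {}" by blast
      from super[OF this] Suc show ?case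
        by (auto simp: lessThan_Suc add.commute intro: order_trans add_left_mono)
    qed
    moreover have "v (\<Union>i<n. A i) \<le> v (\<Union>i. A i)" for n
      unfolding v_def by (rule SUP_subset_mono) auto
    ultimately have "(\<Sum>i. v (A i)) \<le> v (\<Union>i. A i)"
      by (subst suminf_eq_SUP) (auto intro!: SUP_least intro: order_trans)
    with upper show "(\<Sum>i. v (A i)) = v (\<Union>i. A i)" by (simp add: antisym)
  qed
  moreover have "positive (sets borel) v" by (simp add: positive_def v_def \<nu>0)
  moreover have "sigma_algebra UNIV (sets (borel :: 'a measure))"
    using sets.sigma_algebra_axioms[of "borel :: 'a measure"] by simp
  ultimately show ?thesis
    using A unfolding jordan_pos_def v_def by (intro emeasure_measure_of_sigma)
qed

lemma sets_jordan_pos [simp]: "sets (jordan_pos \<nu>) = sets borel"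
  unfolding jordan_pos_def
  by (subst sets_measure_of) (auto simp: sets.sigma_sets_eq[of borel, unfolded space_borel])

lemma sets_jordan_neg [simp]: "sets (jordan_neg \<nu>) = sets borel"
  by (simp add: jordan_neg_def)


section \<open>The function class assumption\<close>

definition Lip :: "('a::real_normed_vector \<Rightarrow> real) \<Rightarrow> ereal" where
  "Lip f = (SUP (x, y)\<in>{(x, y). x \<noteq> y}. ereal (\<bar>f x - f y\<bar> / norm (x - y)))"

text \<open>
  Independent uniform signs \<open>\<xi>\<^sub>0, \<dots>, \<xi>\<^sub>n\<^sub>-\<^sub>1\<close>; coordinates outside \<open>{..<n}\<close> are \<open>0\<close> and play no role.
\<close>

definition rademacher_signs :: "nat \<Rightarrow> (nat \<Rightarrow> real) pmf" where
  "rademacher_signs n = Pi_pmf {..<n} 0 (\<lambda>_. pmf_of_set {-1, 1})"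

definition rademacher_complexity :: "('a \<Rightarrow> real) set \<Rightarrow> nat \<Rightarrow> (nat \<Rightarrow> 'a) \<Rightarrow> ennreal" where
  "rademacher_complexity \<Phi> n x = ennreal (1 / real n) *
     (\<integral>\<^sup>+ \<xi>. (SUP f\<in>\<Phi>. ennreal \<bar>\<Sum>i<n. \<xi> i * f (x i)\<bar>) \<partial>measure_pmf (rademacher_signs n))"

definition function_class_assumption ::
    "('a::euclidean_space \<Rightarrow> real) set \<Rightarrow> real \<Rightarrow> real \<Rightarrow> real \<Rightarrow> bool" where
  "function_class_assumption \<Phi> A1 A2 A3 \<longleftrightarrow>
     (\<forall>\<nu>. signed_measure \<nu> \<longrightarrow> (\<forall>f\<in>\<Phi>. has_signed_integral f 0 \<nu>) \<longrightarrow>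
        (\<forall>A\<in>sets borel. \<nu> A = 0)) \<and>
     ereal A1 = (SUP f\<in>\<Phi>. Lip f) \<and>
     ereal A2 = (SUP f\<in>\<Phi>. ereal \<bar>f 0\<bar>) \<and>
     A3 > 0 \<and>
     (\<forall>n\<ge>1. \<forall>x :: nat \<Rightarrow> 'a. rademacher_complexity \<Phi> n x
        \<le> ennreal (A3 / real n * sqrt (\<Sum>i<n. ((norm (x i))\<^sup>2 + 1))))"

definition P1 :: "'a::euclidean_space measure set" where
  "P1 = {M. prob_space M \<and> sets M = sets borel \<and> integrable M norm}"

end

theory Submission
  imports Defs
begin

text \<open>
  Everything reduces to one duality: for a finite kernel combination \<open>g = \<Sum>i. c\<^sub>i k(\<cdot>, x\<^sub>i)\<close>, the
  largest value of \<open>\<Sum>i. c\<^sub>i f(x\<^sub>i)\<close> over the unit ball is the norm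
  \<open>sqrt (\<Sum>i j. c\<^sub>i c\<^sub>j k(x\<^sub>i, x\<^sub>j))\<close> of \<open>g\<close>, attained at the normalised \<open>g\<close>. Taking \<open>f x - f y\<close> and
  \<open>f 0\<close> gives both constants exactly. With random signs as coefficients the cross terms vanish in
  expectation, so the Rademacher complexity is controlled by \<open>\<Sum>i. k(x\<^sub>i, x\<^sub>i)\<close>, and
  \<open>sqrt (k(x, x)) \<le> K2 + K1 * norm x\<close>.
\<close>

lemma Lip_le_iff:
  "Lip f \<le> ereal A \<longleftrightarrow> (\<forall>x y. \<bar>f x - f y\<bar> \<le> A * norm (x - y))"
  unfolding Lip_def SUP_le_iff
proof safe
  fix x y :: 'a
  assume *: "\<forall>i\<in>{(x, y). x \<noteq> y}. (case i of (x, y) \<Rightarrow> ereal (\<bar>f x - f y\<bar> / norm (x - y))) \<le> ereal A"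
  show "\<bar>f x - f y\<bar> \<le> A * norm (x - y)"
  proof (cases "x = y")
    case False
    with * have "\<bar>f x - f y\<bar> / norm (x - y) \<le> A" by auto
    with False show ?thesis by (simp add: divide_le_eq)
  qed simp
qed (simp add: divide_le_eq)

section \<open>Moments of the random signs\<close>

lemma finite_set_rademacher_signs: "finite (set_pmf (rademacher_signs n))"
  unfolding rademacher_signs_def by (simp add: set_Pi_pmf finite_PiE_dflt)

lemma map_pmf_rademacher_signs: "i < n \<Longrightarrow> map_pmf (\<lambda>\<xi>. \<xi> i) (rademacher_signs n) = pmf_of_set {-1, 1}"
  unfolding rademacher_signs_def by (simp add: Pi_pmf_component)

lemma expectation_rademacher_component:
  assumes "i < n"
  shows "measure_pmf.expectation (rademacher_signs n) (\<lambda>\<xi>. g (\<xi> i) :: real) = (g (-1) + g 1) / 2"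
proof -
  have "measure_pmf.expectation (rademacher_signs n) (\<lambda>\<xi>. g (\<xi> i))
      = measure_pmf.expectation (map_pmf (\<lambda>\<xi>. \<xi> i) (rademacher_signs n)) g"
    by simp
  also have "\<dots> = (g (-1) + g 1) / 2"
    unfolding map_pmf_rademacher_signs[OF assms] by (subst integral_pmf_of_set) auto
  finally show ?thesis .
qed

text \<open>On the diagonal the square of a sign is 1. Off the diagonal, independence factors the
  expectation into a product of zero means.\<close>

lemma expectation_rademacher_mult:
  assumes "i < n" "j < n"
  shows "measure_pmf.expectation (rademacher_signs n) (\<lambda>\<xi>. \<xi> i * \<xi> j) = of_bool (i = j)"
proof (cases "i = j")
  case True
  then show ?thesis using expectation_rademacher_component[OF assms(2), of "\<lambda>t. t * t"] by simp
next
  case False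
  note ps = measure_pmf.prob_space_axioms
  let ?P = "measure_pmf (rademacher_signs n)"
  have "prob_space.indep_vars ?P (\<lambda>_. count_space UNIV) (\<lambda>l \<xi>. \<xi> l) {..<n}"
    unfolding rademacher_signs_def by (rule indep_vars_Pi_pmf) simp
  then have "prob_space.indep_vars ?P (\<lambda>_. count_space UNIV) (\<lambda>l \<xi>. \<xi> l) {i, j}"
    by (rule prob_space.indep_vars_subset[OF ps]) (use assms in auto)
  then have "prob_space.indep_vars ?P (\<lambda>_. borel) (\<lambda>l \<xi>. \<xi> l :: real) {i, j}"
    by (rule prob_space.indep_vars_compose2[OF ps]) auto
  then have "measure_pmf.expectation (rademacher_signs n) (\<lambda>\<xi>. \<Prod>l\<in>{i, j}. \<xi> l)
      = (\<Prod>l\<in>{i, j}. measure_pmf.expectation (rademacher_signs n) (\<lambda>\<xi>. \<xi> l))"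
    by (intro prob_space.indep_vars_lebesgue_integral[OF ps] integrable_measure_pmf_finite
        finite_set_rademacher_signs) auto
  then show ?thesis
    using False expectation_rademacher_component[OF assms(1), of "\<lambda>t. t"] by simp
qed

lemma expectation_rademacher_quadratic:
  "measure_pmf.expectation (rademacher_signs n) (\<lambda>\<xi>. \<Sum>i<n. \<Sum>j<n. \<xi> i * \<xi> j * M i j) = (\<Sum>i<n. M i i)"
proof -
  have int: "integrable (measure_pmf (rademacher_signs n)) g" for g :: "_ \<Rightarrow> real"
    by (rule integrable_measure_pmf_finite[OF finite_set_rademacher_signs])
  have "measure_pmf.expectation (rademacher_signs n) (\<lambda>\<xi>. \<Sum>i<n. \<Sum>j<n. \<xi> i * \<xi> j * M i j)
      = (\<Sum>i<n. \<Sum>j<n. of_bool (i = j) * M i j)"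
    by (simp add: Bochner_Integration.integral_sum int expectation_rademacher_mult)
  then show ?thesis by (simp add: of_bool_def if_distrib[of "\<lambda>c. c * _"] cong: if_cong)
qed

section \<open>Duality between kernel combinations and the unit ball\<close>

context
  fixes k :: "'a \<Rightarrow> 'a \<Rightarrow> real"
  assumes k: "positive_kernel k"
begin

text \<open>The points \<open>x i\<close> may repeat, whereas \<open>kernel_comb\<close> sums over a
  set of points. Adding one section at a time merges repetitions.\<close>

lemma kernel_sum_in_span: "(\<lambda>y. \<Sum>i<(n::nat). c i * k y (x i)) \<in> kernel_span k"
proof (induction n)
  case 0
  have "(\<lambda>_. 0) = kernel_comb k {} (\<lambda>_. 0)" by (simp add: kernel_comb_def)
  then show ?case by (metis (no_types, lifting) finite.emptyI kernel_comb_in_span lessThan_0 sum.empty ext)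
next
  case (Suc n)
  have "(\<lambda>y. k y (x n)) \<in> kernel_span k"
    by (simp add: kernel_section_eq_comb kernel_comb_in_span)
  from kernel_span_lincomb[OF Suc this, of 1 "c n"] show ?case by simp
qed

lemma pre_inner_kernel_sum:
  assumes f: "f \<in> kernel_span k"
  shows "pre_inner k f (\<lambda>y. \<Sum>i<(n::nat). c i * k y (x i)) = (\<Sum>i<n. c i * f (x i))"
proof (induction n)
  case 0
  show ?case using pre_inner_comb_right[OF k f, of "{}"] by (simp add: kernel_comb_def)
next
  case (Suc n)
  have s: "(\<lambda>y. k y (x n)) \<in> kernel_span k"
    by (simp add: kernel_section_eq_comb kernel_comb_in_span)
  from pre_inner_lincomb_right[OF k kernel_sum_in_span s f, where c = 1 and d = "c n"] Suc
  show ?case by (simp add: pre_inner_section[OF k f])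
qed

lemma pre_norm_kernel_sum:
  "pre_norm k (\<lambda>y. \<Sum>i<(n::nat). c i * k y (x i)) = sqrt (\<Sum>i<n. \<Sum>j<n. c i * c j * k (x i) (x j))"
  by (simp add: pre_norm_def pre_inner_kernel_sum[OF kernel_sum_in_span] sum_distrib_left mult_ac)

lemma rkhs_norm_span: "f \<in> kernel_span k \<Longrightarrow> rkhs_norm k f = pre_norm k f"
  using rkhs_inner_eqI[OF k rkhs_approx_const[OF k] rkhs_approx_const[OF k] tendsto_const]
  by (simp add: rkhs_norm_def pre_norm_def)

text \<open>The sum is the inner product of \<open>f\<close> with the combination \<open>?g\<close>.
  Cauchy-Schwarz is applied in the span to the approximants \<open>F m\<close> and passes to the
  limit, because their values and norms converge.\<close>

lemma rkhs_unit_ball_bound: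
  assumes f: "f \<in> rkhs_unit_ball k"
  shows "\<bar>\<Sum>i<(n::nat). c i * f (x i)\<bar> \<le> sqrt (\<Sum>i<n. \<Sum>j<n. c i * c j * k (x i) (x j))"
proof -
  let ?g = "\<lambda>y. \<Sum>i<n. c i * k y (x i)"
  obtain F where F: "rkhs_approx k F f" using f by (auto simp: rkhs_unit_ball_def rkhs_def)
  have sp: "F m \<in> kernel_span k" for m by (rule rkhs_approx_span[OF k F])
  have norm: "(\<lambda>m. pre_norm k (F m)) \<longlonglongrightarrow> rkhs_norm k f"
    using tendsto_real_sqrt[OF rkhs_inner_LIMSEQ[OF k F F]] by (simp add: pre_norm_def rkhs_norm_def)
  have "(\<lambda>m. \<bar>\<Sum>i<n. c i * F m (x i)\<bar>) \<longlonglongrightarrow> \<bar>\<Sum>i<n. c i * f (x i)\<bar>"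
    using F by (intro tendsto_intros) (auto simp: rkhs_approx_def)
  moreover have "(\<lambda>m. pre_norm k (F m) * pre_norm k ?g) \<longlonglongrightarrow> rkhs_norm k f * pre_norm k ?g"
    by (intro tendsto_intros norm)
  moreover have "\<bar>\<Sum>i<n. c i * F m (x i)\<bar> \<le> pre_norm k (F m) * pre_norm k ?g" for m
    using pre_inner_Cauchy_Schwarz[OF k sp kernel_sum_in_span] by (simp add: pre_inner_kernel_sum sp)
  ultimately have "\<bar>\<Sum>i<n. c i * f (x i)\<bar> \<le> rkhs_norm k f * pre_norm k ?g"
    by (intro LIMSEQ_le) auto
  also have "\<dots> \<le> 1 * pre_norm k ?g"
    using f by (intro mult_right_mono pre_norm_nonneg[OF k] kernel_sum_in_span)
      (simp add: rkhs_unit_ball_def)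
  finally show ?thesis by (simp add: pre_norm_kernel_sum)
qed

text \<open>If the norm of \<open>g\<close> is 0, division by zero gives the zero function, which
  also lies in the ball; degenerate kernels are thus covered.\<close>

lemma normalized_in_rkhs_unit_ball:
  assumes g: "g \<in> kernel_span k"
  shows "(\<lambda>y. g y / pre_norm k g) \<in> rkhs_unit_ball k"
proof -
  let ?f = "\<lambda>y. g y / pre_norm k g"
  have f: "?f \<in> kernel_span k" using kernel_span_lincomb[OF g g, of "1 / pre_norm k g" 0] by simp
  have "pre_norm k ?f \<le> 1"
    using pre_norm_triangle[OF k g g, of "1 / pre_norm k g" 0] pre_norm_nonneg[OF k g]
    by (cases "pre_norm k g = 0") auto
  then show ?thesis
    using f kernel_span_subset_rkhs[OF k] by (auto simp: rkhs_unit_ball_def rkhs_norm_span)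
qed

text \<open>Equality case of Cauchy-Schwarz: the witness is the combination divided by its norm. For
  norm 0 both sides are 0.\<close>

lemma rkhs_unit_ball_attains:
  "\<exists>f\<in>rkhs_unit_ball k. (\<Sum>i<(n::nat). c i * f (x i)) = sqrt (\<Sum>i<n. \<Sum>j<n. c i * c j * k (x i) (x j))"
proof -
  let ?g = "\<lambda>y. \<Sum>i<n. c i * k y (x i)"
  have "(\<Sum>i<n. c i * (g (x i) / N)) = (\<Sum>i<n. c i * g (x i)) / N" for g and N :: real
    by (simp add: sum_divide_distrib)
  then have "(\<Sum>i<n. c i * (?g (x i) / pre_norm k ?g)) = (\<Sum>i<n. c i * ?g (x i)) / pre_norm k ?g"
    .
  also have "\<dots> = pre_inner k ?g ?g / pre_norm k ?g"
    by (simp only: pre_inner_kernel_sum[OF kernel_sum_in_span])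
  also have "\<dots> = pre_norm k ?g"
    by (simp add: pre_norm_def pre_inner_nonneg[OF k kernel_sum_in_span] real_div_sqrt)
  finally show ?thesis
    unfolding pre_norm_kernel_sum[symmetric]
    by (rule bexI[OF _ normalized_in_rkhs_unit_ball[OF kernel_sum_in_span]])
qed

text \<open>Carries vanishing integrals from the unit ball over to the kernel sections, to which the
  hypothesis on signed measures applies.\<close>

lemma kernel_section_multiple_unit_ball: "\<exists>c. \<exists>f\<in>rkhs_unit_ball k. \<forall>y. k x y = c * f y"
proof -
  let ?c = "pre_norm k (\<lambda>y. k y x)"
  have g: "(\<lambda>y. k y x) \<in> kernel_span k"
    by (simp add: kernel_section_eq_comb kernel_comb_in_span)
  have eq: "k x y = ?c * (k y x / ?c)" for y
  proof (cases "?c = 0")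
    case True
    \<comment> \<open>A section of norm 0 vanishes at every \<open>y\<close>, by Cauchy-Schwarz
      against the section at \<open>y\<close>.\<close>
    have "\<bar>k y x\<bar> \<le> pre_norm k (\<lambda>z. k z y) * ?c"
      using pre_inner_Cauchy_Schwarz[OF k _ g, of "\<lambda>z. k z y"] pre_inner_section[OF k, of "\<lambda>z. k z y" x]
      by (simp add: kernel_section_eq_comb kernel_comb_in_span kernel_sym[OF k, of x y])
    with True show ?thesis by (simp add: kernel_sym[OF k, of x y])
  qed (simp add: kernel_sym[OF k, of x y])
  show ?thesis
    by (intro exI[of _ ?c] bexI[OF _ normalized_in_rkhs_unit_ball[OF g]]) (use eq in blast)
qed

section \<open>Differences and point values, from coefficients (1, -1) and (1)\<close>

lemma rkhs_unit_ball_diff_le: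
  "f \<in> rkhs_unit_ball k \<Longrightarrow> \<bar>f x - f y\<bar> \<le> sqrt (k x x + k y y - 2 * k x y)"
  using rkhs_unit_ball_bound[of f, where n = 2 and c = "\<lambda>i. if i = 0 then 1 else -1"
      and x = "\<lambda>i. if i = 0 then x else y"]
  by (simp add: numeral_2_eq_2 kernel_sym[OF k, of y x] algebra_simps)

lemma rkhs_unit_ball_diff_attains:
  "\<exists>f\<in>rkhs_unit_ball k. f x - f y = sqrt (k x x + k y y - 2 * k x y)"
  using rkhs_unit_ball_attains[where n = 2 and c = "\<lambda>i. if i = 0 then 1 else -1"
      and x = "\<lambda>i. if i = 0 then x else y"]
  by (simp add: numeral_2_eq_2 kernel_sym[OF k, of y x] algebra_simps)

lemma rkhs_unit_ball_le: "f \<in> rkhs_unit_ball k \<Longrightarrow> \<bar>f x\<bar> \<le> sqrt (k x x)"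
  using rkhs_unit_ball_bound[of f, where n = 1 and c = "\<lambda>_. 1" and x = "\<lambda>_. x"] by simp

lemma rkhs_unit_ball_value_attains: "\<exists>f\<in>rkhs_unit_ball k. f x = sqrt (k x x)"
  using rkhs_unit_ball_attains[where n = 1 and c = "\<lambda>_. 1" and x = "\<lambda>_. x"] by simp

text \<open>The triangle inequality for the norms of the sections, tested on a ball function that
  attains the left side at \<open>x\<close>.\<close>

lemma sqrt_kernel_triangle: "sqrt (k x x) \<le> sqrt (k y y) + sqrt (k x x + k y y - 2 * k x y)"
proof -
  obtain f where f: "f \<in> rkhs_unit_ball k" "f x = sqrt (k x x)"
    using rkhs_unit_ball_value_attains by blast
  then show ?thesis using rkhs_unit_ball_le[OF f(1), of y] rkhs_unit_ball_diff_le[OF f(1), of x y]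
    by linarith
qed

text \<open>For each sign vector, duality bounds the supremum by the square root of the quadratic
  form \<open>Q\<close>, whose expectation is the diagonal sum, at most the square of
  \<open>s\<close>.\<close>

lemma rademacher_complexity_rkhs_unit_ball:
  assumes n: "n \<ge> 1" and s: "s > 0" and le: "(\<Sum>i<n. k (x i) (x i)) \<le> s\<^sup>2"
  shows "rademacher_complexity (rkhs_unit_ball k) n x \<le> ennreal (s / real n)"
proof -
  let ?P = "measure_pmf (rademacher_signs n)"
  define Q where "Q \<xi> = (\<Sum>i<n. \<Sum>j<n. \<xi> i * \<xi> j * k (x i) (x j))" for \<xi> :: "nat \<Rightarrow> real"
  have int: "integrable ?P g" for g :: "_ \<Rightarrow> real"
    by (rule integrable_measure_pmf_finite[OF finite_set_rademacher_signs])
  have Q0: "Q \<xi> \<ge> 0" for \<xi> using k unfolding positive_kernel_def Q_def by blast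
  \<comment> \<open>AM-GM replaces Jensen's inequality: \<open>2 s \<surd>Q \<le> Q + s\<^sup>2\<close>\<close>
  have amgm: "sqrt (Q \<xi>) \<le> (Q \<xi> / s + s) / 2" for \<xi>
  proof -
    have "0 \<le> (sqrt (Q \<xi>) - s)\<^sup>2" by simp
    then have "2 * s * sqrt (Q \<xi>) \<le> Q \<xi> + s\<^sup>2" using Q0[of \<xi>] by (simp add: power2_diff mult_ac)
    then show ?thesis using s by (simp add: field_simps power2_eq_square)
  qed
  have "(\<integral>\<^sup>+ \<xi>. (SUP f\<in>rkhs_unit_ball k. ennreal \<bar>\<Sum>i<n. \<xi> i * f (x i)\<bar>) \<partial>?P)
      \<le> (\<integral>\<^sup>+ \<xi>. ennreal ((Q \<xi> / s + s) / 2) \<partial>?P)"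
    by (intro nn_integral_mono SUP_least ennreal_leI order_trans[OF rkhs_unit_ball_bound])
      (use amgm in \<open>simp_all add: Q_def\<close>)
  also have "\<dots> = ennreal (\<integral>\<xi>. (Q \<xi> / s + s) / 2 \<partial>?P)"
    using Q0 s by (intro nn_integral_eq_integral int) auto
  also have "(\<integral>\<xi>. (Q \<xi> / s + s) / 2 \<partial>?P) = ((\<Sum>i<n. k (x i) (x i)) / s + s) / 2"
    using expectation_rademacher_quadratic[of n "\<lambda>i j. k (x i) (x j)"]
    by (simp add: int Q_def[symmetric])
  also have "ennreal \<dots> \<le> ennreal s"
    using le s by (intro ennreal_leI) (simp add: field_simps power2_eq_square)
  finally show ?thesis
    unfolding rademacher_complexity_def using n s
    by (subst divide_inverse, subst mult.commute, subst ennreal_mult)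
       (auto simp: inverse_eq_divide intro: mult_left_mono)
qed

end

section \<open>Verification of the function class assumption\<close>

lemma has_signed_integral_cmult:
  assumes "has_signed_integral f r \<nu>"
  shows "has_signed_integral (\<lambda>x. c * f x) (c * r) \<nu>"
  using assms by (simp add: has_signed_integral_def right_diff_distrib)

text \<open>The bound with \<open>K1\<close> survives enlarging \<open>K1\<close>, so the supremum
  \<open>A1\<close> of the Lipschitz constants may be smaller; it equals \<open>K1\<close> once
  \<open>K1\<close> is the least positive admissible constant.\<close>

theorem theorem3p1:
  fixes k :: "real^'d \<Rightarrow> real^'d \<Rightarrow> real"
    and K1 K2 :: real
    and \<mu> :: "(real^'d) measure"
  assumes "positive_kernel k"
    and "K1 > 0" and "K2 > 0"
    and "\<And>x y. k x x + k y y - 2 * k x y \<le> K1\<^sup>2 * (norm (x - y))\<^sup>2"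
    and "K2 = sqrt (k 0 0)"
    and "\<And>\<nu>. signed_measure \<nu> \<Longrightarrow> (\<forall>x. has_signed_integral (\<lambda>y. k x y) 0 \<nu>)
           \<Longrightarrow> (\<forall>A\<in>sets borel. \<nu> A = 0)"
    and "\<mu> \<in> P1"
  shows "\<exists>A1\<le>K1. function_class_assumption (rkhs_unit_ball k) A1 K2 (sqrt 2 * max K1 K2) \<and>
           ((\<forall>C>0. (\<forall>x y. k x x + k y y - 2 * k x y \<le> C\<^sup>2 * (norm (x - y))\<^sup>2) \<longrightarrow> K1 \<le> C)
              \<longrightarrow> A1 = K1)"
proof -
  note k = assms(1)
  let ?B = "rkhs_unit_ball k"
  let ?L = "SUP f\<in>?B. Lip f"
  have dist_le: "sqrt (k x x + k y y - 2 * k x y) \<le> K1 * norm (x - y)" for x y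
    using assms(2) assms(4)[of x y] by (intro real_le_lsqrt) (auto simp: power_mult_distrib)
  obtain f0 where f0: "f0 \<in> ?B" "f0 0 = K2"
    using rkhs_unit_ball_value_attains[OF k, of 0] assms(5) by auto
  have "?L \<le> ereal K1"
    using rkhs_unit_ball_diff_le[OF k] dist_le
    by (intro SUP_least) (fastforce simp: Lip_le_iff intro: order_trans)
  \<comment> \<open>Excludes minus infinity, so that the extended real \<open>?L\<close> is a real
    number.\<close>
  moreover have "0 \<le> ?L"
  proof -
    have "0 \<le> Lip f0" unfolding Lip_def
      by (rule SUP_upper2[of "(0, axis undefined 1)"]) (auto simp: axis_eq_0_iff)
    then show ?thesis using f0(1) by (auto intro: SUP_upper2)
  qed
  ultimately obtain A1 where A1: "?L = ereal A1" "0 \<le> A1" "A1 \<le> K1"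
    by (cases ?L) auto
  \<comment> \<open>\<open>A1\<close> is itself admissible in the kernel inequality: the ball
    function attaining the kernel distance of \<open>x\<close> and \<open>y\<close> has Lipschitz
    constant at most \<open>A1\<close>.\<close>
  have A1_dist: "k x x + k y y - 2 * k x y \<le> A1\<^sup>2 * (norm (x - y))\<^sup>2" for x y
  proof -
    obtain f where f: "f \<in> ?B" "f x - f y = sqrt (k x x + k y y - 2 * k x y)"
      using rkhs_unit_ball_diff_attains[OF k] by blast
    have "Lip f \<le> ereal A1" using f(1) by (auto simp flip: A1(1) intro: SUP_upper)
    then have "sqrt (k x x + k y y - 2 * k x y) \<le> A1 * norm (x - y)"
      unfolding Lip_le_iff f(2)[symmetric] using abs_ge_self order_trans by blast
    from sqrt_le_D[OF this] show ?thesis by (simp add: power_mult_distrib)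
  qed
  have minimal: "A1 = K1"
    if C: "\<forall>C>0. (\<forall>x y. k x x + k y y - 2 * k x y \<le> C\<^sup>2 * (norm (x - y))\<^sup>2) \<longrightarrow> K1 \<le> C"
  proof (cases "A1 = 0")
    \<comment> \<open>Minimality ranges over positive constants only, so \<open>A1 = 0\<close> is
      excluded separately: \<open>K1 / 2\<close> would be admissible.\<close>
    case True
    with A1_dist have "k x x + k y y - 2 * k x y \<le> (K1 / 2)\<^sup>2 * (norm (x - y))\<^sup>2" for x y
      by (auto intro: order_trans[of _ 0])
    with C[rule_format, of "K1 / 2"] assms(2) show ?thesis by simp
  next
    case False
    with C[rule_format, of A1] A1(2,3) A1_dist show ?thesis by simp
  qed
  have "\<nu> A = 0" if \<nu>: "signed_measure \<nu>" "\<forall>f\<in>?B. has_signed_integral f 0 \<nu>" "A \<in> sets borel" for \<nu> A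
  proof -
    have "has_signed_integral (\<lambda>y. k x y) 0 \<nu>" for x
    proof -
      obtain c f where f: "f \<in> ?B" "(\<lambda>y. k x y) = (\<lambda>y. c * f y)"
        using kernel_section_multiple_unit_ball[OF k, of x] by metis
      then show ?thesis using has_signed_integral_cmult[of f 0 \<nu> c] \<nu>(2) by simp
    qed
    with assms(6)[OF \<nu>(1)] \<nu>(3) show ?thesis by blast
  qed
  moreover have "ereal K2 = (SUP f\<in>?B. ereal \<bar>f 0\<bar>)"
    using rkhs_unit_ball_le[OF k, of _ 0] assms(3,5) f0
    by (intro antisym SUP_least SUP_upper2[of f0]) auto
  moreover have "rademacher_complexity ?B n x
      \<le> ennreal (sqrt 2 * max K1 K2 / real n * sqrt (\<Sum>i<n. ((norm (x i))\<^sup>2 + 1)))"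
    if n: "n \<ge> 1" for n and x :: "nat \<Rightarrow> real^'d"
  proof -
    let ?m = "max K1 K2"
    \<comment> \<open>This is positive because \<open>n\<close> is at least 1; the complexity bound
      divides by it.\<close>
    let ?s = "sqrt 2 * ?m * sqrt (\<Sum>i<n. ((norm (x i))\<^sup>2 + 1))"
    have m: "?m > 0" using assms(2) by simp
    have pos: "(\<Sum>i<n. ((norm (x i))\<^sup>2 + 1)) > 0"
      using n by (intro sum_pos) (auto simp: lessThan_empty_iff add_nonneg_pos)
    have diag: "k z z \<le> 2 * ?m\<^sup>2 * ((norm z)\<^sup>2 + 1)" for z
    proof -
      have "sqrt (k z z) \<le> K2 + K1 * norm z"
        using sqrt_kernel_triangle[OF k, of z 0] dist_le[of z 0] assms(5) by simp
      also have "\<dots> \<le> ?m + ?m * norm z"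
        by (intro add_mono mult_right_mono) auto
      finally have "k z z \<le> (?m + ?m * norm z)\<^sup>2" by (rule sqrt_le_D)
      also have "\<dots> \<le> 2 * ?m\<^sup>2 * ((norm z)\<^sup>2 + 1)"
        \<comment> \<open>With \<open>t = norm z\<close>, this is
          \<open>(1 + t)^2 <= 2 * (1 + t^2)\<close> scaled by the square of \<open>?m\<close>; the 2
          becomes the factor \<open>sqrt 2\<close> of the third constant.\<close>
        using zero_le_power2[of "?m * norm z - ?m"]
        by (simp add: power2_eq_square algebra_simps)
      finally show ?thesis .
    qed
    have "(\<Sum>i<n. k (x i) (x i)) \<le> ?s\<^sup>2"
      using sum_mono[of "{..<n}", OF diag] pos
      by (simp add: power_mult_distrib sum_distrib_left)
    from rademacher_complexity_rkhs_unit_ball[OF k n _ this] m pos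
    show ?thesis by simp
  qed
  ultimately have "function_class_assumption ?B A1 K2 (sqrt 2 * max K1 K2)"
    using A1(1) assms(2) unfolding function_class_assumption_def by auto
  with A1(3) minimal show ?thesis by blast
qed

end
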